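(* Let $\lambda = (\lambda_1,\dots,\lambda_n)\in\mathbb{Z}_+^n$, let $i\in\{1,\dots,n\}$ and let $\ell_i = \operatorname{lcm}(\lambda_1,\dots,\lambda_{i-1},\lambda_{i+1},\dots,\lambda_n)$. Then $$\mu_{norm}(\Delta(\lambda)) = \mu_{norm}(\Delta(\lambda_1,\dots,\lambda_{i-1},\lambda_i+\ell_i,\lambda_{i+1},\dots,\lambda_n)).$$
   Context: $\mathbb{Z}_+$ is the set of positive integers. For $\lambda\in\mathbb{Z}_+^n$, the rectangular simplex $\Delta(\lambda) \subset \mathbb{R}^n$ is the convex hull of $\{0,\lambda_1 e_1,\dots,\lambda_n e_n\}$. A lattice polytope $Q \subset \mathbb{R}^n$ is normal if for every integer $k \ge 1$ every $x \in kQ \cap \mathbb{Z}^n$ is a sum of $k$ points of $Q\cap\mathbb{Z}^n$. The normality index is $\mu_{norm}(Q) = \min\{k_0 \in\mathbb{Z}_+ : kQ \text{ is normal for all } k \ge k_0\}$. *)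

theory Defs
  imports "HOL-Analysis.Analysis"
begin

definition lattice_points :: "(real ^ 'n) set" where
  "lattice_points = {x. \<forall>j. x $ j \<in> \<int>}"

definition dilate :: "nat \<Rightarrow> (real ^ 'n) set \<Rightarrow> (real ^ 'n) set" where
  "dilate k Q = (\<lambda>x. real k *\<^sub>R x) ` Q"

definition rect_simplex :: "nat ^ 'n \<Rightarrow> (real ^ 'n) set" where
  "rect_simplex lam = convex hull (insert 0 (range (\<lambda>j. real (lam $ j) *\<^sub>R axis j 1)))"

text \<open>Meaningful when \<open>Q\<close> is a lattice polytope. The \<open>k\<close> summands are
  given by a function on \<open>{..<k}\<close>, so repetitions are allowed.\<close>

definition normal_polytope :: "(real ^ 'n) set \<Rightarrow> bool" where
  "normal_polytope Q \<longleftrightarrow>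
     (\<forall>k\<ge>1. \<forall>x \<in> dilate k Q \<inter> lattice_points.
        \<exists>y. (\<forall>m<k. y m \<in> Q \<inter> lattice_points) \<and> x = (\<Sum>m<k. y m))"

text \<open>For a lattice polytope \<open>Q\<close> of dimension \<open>d\<close>, \<open>dilate k Q\<close> is normal for all
  \<open>k \<ge> max 1 (d - 1)\<close>, so the minimum below is attained.\<close>

definition mu_norm :: "(real ^ 'n) set \<Rightarrow> nat" where
  "mu_norm Q = (LEAST k0. k0 \<ge> 1 \<and> (\<forall>k\<ge>k0. normal_polytope (dilate k Q)))"

end

(* Put L for a common multiple of the lambda_j with j distinct from i, and let
   w(x) be L times the sum of the x_j / lambda_j over these j; it is an integer
   at lattice points.  The shear that adds k L - w(x) to the i-th coordinate is
   additive in the pair (k, x) and preserves the inequality describing the k-th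
   dilate while replacing lambda_i by lambda_i + L.  It fails to be a bijection
   only through the sign condition on the i-th coordinate, which is repaired by
   truncating at 0: an i-th coordinate that is too large can always be lowered.
   Hence normality is unaffected, and this applies to every multiple of lambda. *)
theory Submission
  imports Defs
begin

abbreviation vec_upd :: "'a ^ 'n \<Rightarrow> 'n \<Rightarrow> 'a \<Rightarrow> 'a ^ 'n" where
  "vec_upd x i c \<equiv> (\<chi> j. if j = i then c else x $ j)"

section \<open>Inequality descriptions of the simplex and its dilates\<close>

text \<open>The right-hand side is a convex set containing the vertices, so it contains the hull.
  Conversely, the numbers \<open>x $ j / lam $ j\<close> are the barycentric coordinates of
  \<open>x\<close> at the axis vertices.\<close>

lemma mem_rect_simplex_iff:
  fixes lam :: "nat ^ 'n"
  assumes pos: "\<And>j. lam $ j > 0"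
  shows "x \<in> rect_simplex lam \<longleftrightarrow>
    (\<forall>j. 0 \<le> x $ j) \<and> (\<Sum>j\<in>UNIV. x $ j / real (lam $ j)) \<le> 1"
proof
  have "convex {x :: real ^ 'n. (\<forall>j. 0 \<le> x $ j) \<and> (\<Sum>j\<in>UNIV. x $ j / real (lam $ j)) \<le> 1}"
    (is "convex ?T")
  proof (rule convexI)
    fix x y :: "real ^ 'n" and u v :: real
    assume xy: "x \<in> ?T" "y \<in> ?T" and uv: "0 \<le> u" "0 \<le> v" "u + v = 1"
    have "(\<Sum>j\<in>UNIV. (u *\<^sub>R x + v *\<^sub>R y) $ j / real (lam $ j))
        = u * (\<Sum>j\<in>UNIV. x $ j / real (lam $ j)) + v * (\<Sum>j\<in>UNIV. y $ j / real (lam $ j))"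
      by (simp add: sum_distrib_left sum.distrib add_divide_distrib)
    also have "\<dots> \<le> u * 1 + v * 1"
      using xy uv by (intro add_mono mult_left_mono) auto
    finally show "u *\<^sub>R x + v *\<^sub>R y \<in> ?T"
      using xy uv by simp
  qed
  moreover have "insert 0 (range (\<lambda>j. real (lam $ j) *\<^sub>R axis j 1)) \<subseteq> ?T"
  proof -
    have "(\<Sum>j\<in>UNIV. (real (lam $ l) *\<^sub>R axis l 1 :: real ^ 'n) $ j / real (lam $ j)) = 1" for l
    proof -
      have "(\<Sum>j\<in>UNIV. (real (lam $ l) *\<^sub>R axis l 1 :: real ^ 'n) $ j / real (lam $ j))
          = (\<Sum>j\<in>UNIV. if j = l then 1 else 0)"
        using pos by (intro sum.cong) (auto simp: axis_def less_imp_neq[symmetric])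
      then show ?thesis by simp
    qed
    then show ?thesis
      by (auto simp: axis_def)
  qed
  ultimately have sub: "rect_simplex lam \<subseteq> ?T"
    unfolding rect_simplex_def by (intro hull_minimal)
  assume "x \<in> rect_simplex lam"
  then have "x \<in> ?T" using sub by blast
  then show "(\<forall>j. 0 \<le> x $ j) \<and> (\<Sum>j\<in>UNIV. x $ j / real (lam $ j)) \<le> 1" by simp
next
  assume x: "(\<forall>j. 0 \<le> x $ j) \<and> (\<Sum>j\<in>UNIV. x $ j / real (lam $ j)) \<le> 1"
  define C where "C = rect_simplex lam"
  have C: "0 \<in> C" "real (lam $ j) *\<^sub>R axis j 1 \<in> C" for j
    unfolding C_def rect_simplex_def by (auto intro: hull_inc)
  define s where "s = (\<Sum>j\<in>UNIV. x $ j / real (lam $ j))"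
  \<comment> \<open>The \<open>n + 1\<close> vertices are indexed by \<open>'n option\<close>:
    \<open>None\<close> stands for the origin, which takes the remaining weight
    \<open>1 - s\<close>.\<close>
  define a where "a = (\<lambda>p. case p of None \<Rightarrow> 1 - s | Some j \<Rightarrow> x $ j / real (lam $ j))"
  define y :: "'n option \<Rightarrow> real ^ 'n"
    where "y = (\<lambda>p. case p of None \<Rightarrow> 0 | Some j \<Rightarrow> real (lam $ j) *\<^sub>R axis j 1)"
  have split: "sum f UNIV = f None + (\<Sum>j\<in>UNIV. f (Some j))"
    for f :: "'n option \<Rightarrow> 'c :: comm_monoid_add"
    by (simp add: UNIV_option_conv sum.reindex)
  have "(\<Sum>p\<in>UNIV. a p *\<^sub>R y p) \<in> C"
  proof (rule convex_sum)
    show "convex C" by (simp add: C_def rect_simplex_def)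
    show "sum a UNIV = 1" by (simp add: split a_def s_def)
    show "0 \<le> a p" for p using x by (auto simp: a_def s_def split: option.split)
    show "y p \<in> C" for p using C by (auto simp: y_def split: option.split)
  qed simp
  also have "(\<Sum>p\<in>UNIV. a p *\<^sub>R y p) = (\<Sum>j\<in>UNIV. x $ j *\<^sub>R axis j 1)"
    using pos by (simp add: split a_def y_def less_imp_neq[symmetric])
  also have "\<dots> = x"
    by (simp add: vec_eq_iff axis_def if_distrib cong: if_cong)
  finally show "x \<in> rect_simplex lam" by (simp add: C_def)
qed

text \<open>Dilates stay within the family of rectangular simplices, so a criterion for the
  normality of simplices also covers all dilates with \<open>k \<ge> 1\<close>.\<close>

lemma dilate_rect_simplex:
  "dilate k (rect_simplex lam) = rect_simplex (\<chi> j. k * lam $ j)"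
proof -
  have "insert 0 (range (\<lambda>j. real (k * lam $ j) *\<^sub>R axis j 1))
      = (\<lambda>x :: real ^ 'a. real k *\<^sub>R x) ` insert 0 (range (\<lambda>j. real (lam $ j) *\<^sub>R axis j 1))"
    by (simp add: image_image)
  then show ?thesis
    unfolding dilate_def rect_simplex_def
    by (simp only: convex_hull_scaling vec_lambda_beta)
qed

text \<open>The term of coordinate \<open>i\<close> stands apart because only \<open>x $ i\<close>
  and \<open>lam $ i\<close> will change later. The bound on \<open>k\<close> keeps the parameters
  \<open>k * lam $ j\<close> positive.\<close>

lemma mem_dilate_rect_simplex_iff:
  fixes lam :: "nat ^ 'n" and x :: "real ^ 'n"
  assumes pos: "\<And>j. lam $ j > 0" and k: "k \<ge> 1"
  shows "x \<in> dilate k (rect_simplex lam) \<longleftrightarrow>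
    (\<forall>j. 0 \<le> x $ j) \<and> (\<Sum>j\<in>UNIV - {i}. x $ j / real (lam $ j)) + x $ i / real (lam $ i) \<le> real k"
proof -
  have "(\<Sum>j\<in>UNIV. x $ j / real (k * lam $ j))
      = (\<Sum>j\<in>UNIV. x $ j / real (lam $ j)) / real k"
    by (simp add: sum_divide_distrib mult.commute)
  moreover have "(\<Sum>j\<in>UNIV. x $ j / real (lam $ j))
      = (\<Sum>j\<in>UNIV - {i}. x $ j / real (lam $ j)) + x $ i / real (lam $ i)"
    by (simp add: sum.remove[of UNIV i])
  ultimately show ?thesis
    using pos k by (simp add: dilate_rect_simplex mem_rect_simplex_iff divide_le_eq)
qed

lemma mem_rect_simplex_split_iff:
  fixes lam :: "nat ^ 'n" and x :: "real ^ 'n"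
  assumes "\<And>j. lam $ j > 0"
  shows "x \<in> rect_simplex lam \<longleftrightarrow>
    (\<forall>j. 0 \<le> x $ j) \<and> (\<Sum>j\<in>UNIV - {i}. x $ j / real (lam $ j)) + x $ i / real (lam $ i) \<le> 1"
proof -
  have "dilate 1 (rect_simplex lam) = rect_simplex lam"
    by (simp add: dilate_def)
  then show ?thesis
    using mem_dilate_rect_simplex_iff[OF assms, of 1 x i] by simp
qed

section \<open>Lowering one coordinate of the summands\<close>

text \<open>Greedy choice: the last index takes as much of \<open>z\<close> as it can hold, and the
  rest is left to the earlier indices.\<close>

lemma Ints_sum_lower:
  fixes c :: "nat \<Rightarrow> real"
  assumes "\<And>m. m < k \<Longrightarrow> c m \<in> \<int> \<and> 0 \<le> c m" "z \<in> \<int>" "0 \<le> z" "z \<le> (\<Sum>m<k. c m)"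
  shows "\<exists>d. (\<forall>m<k. d m \<in> \<int> \<and> 0 \<le> d m \<and> d m \<le> c m) \<and> (\<Sum>m<k. d m) = z"
  using assms
proof (induction k arbitrary: z)
  case 0
  then show ?case by simp
next
  case (Suc k)
  \<comment> \<open>The remainder \<open>z - e\<close> is either 0 or \<open>z - c k\<close>, and in
    both cases the first \<open>k\<close> bounds suffice for it.\<close>
  define e where "e = min (c k) z"
  have e: "e \<in> \<int>" "0 \<le> e" "e \<le> c k" "e \<le> z"
    using Suc.prems(1)[of k] Suc.prems(2,3) by (auto simp: e_def min_def)
  have "0 \<le> (\<Sum>m<k. c m)" using Suc.prems(1) by (intro sum_nonneg) auto
  then have "z - e \<le> (\<Sum>m<k. c m)" using Suc.prems(4) by (auto simp: e_def)
  with e Suc obtain d where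
    d: "\<forall>m<k. d m \<in> \<int> \<and> 0 \<le> d m \<and> d m \<le> c m" "(\<Sum>m<k. d m) = z - e"
    using Suc.IH[of "z - e"] by (metis Ints_diff diff_ge_0_iff_ge less_SucI)
  let ?d = "\<lambda>m. if m = k then e else d m"
  have "(\<Sum>m<k. ?d m) = (\<Sum>m<k. d m)" by (intro sum.cong) auto
  then have "(\<Sum>m<Suc k. ?d m) = z" using d by simp
  moreover have "\<forall>m<Suc k. ?d m \<in> \<int> \<and> 0 \<le> ?d m \<and> ?d m \<le> c m"
    using d e by (auto simp: less_Suc_eq)
  ultimately show ?case by (intro exI[of _ ?d] conjI)
qed

text \<open>A point of the simplex stays in it when coordinate \<open>i\<close> is lowered to a
  nonnegative value, so an excess in that coordinate can be removed from the summands. This absorbs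
  the error that truncation at 0 creates.\<close>

lemma normal_rect_simplexI:
  fixes lam :: "nat ^ 'n"
  assumes pos: "\<And>j. lam $ j > 0"
    and ex: "\<And>k x. \<lbrakk>k \<ge> 1; x \<in> dilate k (rect_simplex lam) \<inter> lattice_points\<rbrakk> \<Longrightarrow>
      \<exists>y. (\<forall>m<k. y m \<in> rect_simplex lam \<inter> lattice_points) \<and>
        (\<forall>j. j \<noteq> i \<longrightarrow> x $ j = (\<Sum>m<k. y m $ j)) \<and> x $ i \<le> (\<Sum>m<k. y m $ i)"
  shows "normal_polytope (rect_simplex lam)"
  unfolding normal_polytope_def
proof (intro allI impI ballI)
  fix k :: nat and x
  assume k: "k \<ge> 1" and x: "x \<in> dilate k (rect_simplex lam) \<inter> lattice_points"
  obtain y where y: "\<And>m. m < k \<Longrightarrow> y m \<in> rect_simplex lam \<inter> lattice_points"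
    and off: "\<And>j. j \<noteq> i \<Longrightarrow> x $ j = (\<Sum>m<k. y m $ j)" and le: "x $ i \<le> (\<Sum>m<k. y m $ i)"
    using ex[OF k x] by blast
  have yi: "y m $ i \<in> \<int> \<and> 0 \<le> y m $ i" if "m < k" for m
    using y[OF that] mem_rect_simplex_iff[OF pos] by (auto simp: lattice_points_def)
  have "x $ i \<in> \<int>" "0 \<le> x $ i"
    using x mem_dilate_rect_simplex_iff[OF pos k] by (auto simp: lattice_points_def)
  with Ints_sum_lower[of k "\<lambda>m. y m $ i", OF yi] le obtain d where
    d: "\<And>m. m < k \<Longrightarrow> d m \<in> \<int> \<and> 0 \<le> d m \<and> d m \<le> y m $ i" "(\<Sum>m<k. d m) = x $ i"
    by blast
  have "vec_upd (y m) i (d m) \<in> rect_simplex lam \<inter> lattice_points" if m: "m < k" for m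
  proof -
    have "d m / real (lam $ i) \<le> y m $ i / real (lam $ i)"
      using d(1)[OF m] by (intro divide_right_mono) auto
    then show ?thesis
      using y[OF m] d(1)[OF m]
      by (auto simp: mem_rect_simplex_split_iff[OF pos, of _ i] lattice_points_def)
  qed
  moreover have "x = (\<Sum>m<k. vec_upd (y m) i (d m))"
  proof (rule vec_eq_iff[THEN iffD2], rule allI)
    show "x $ j = (\<Sum>m<k. vec_upd (y m) i (d m)) $ j" for j
      using off[of j] d(2) by (cases "j = i") simp_all
  qed
  ultimately show "\<exists>y. (\<forall>m<k. y m \<in> rect_simplex lam \<inter> lattice_points) \<and> x = (\<Sum>m<k. y m)"
    by (intro exI[of _ "\<lambda>m. vec_upd (y m) i (d m)"] conjI allI impI)
qed

section \<open>The shear and its effect on normality\<close>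

text \<open>After multiplication by \<open>a + L\<close> the term \<open>L * (t - w)\<close> occurs
  on both sides and cancels.\<close>

lemma shear_le_iff:
  fixes a L t w z :: real
  assumes "a > 0" "L > 0"
  shows "w + (z + L * (t - w)) / (a + L) \<le> t \<longleftrightarrow> w + z / a \<le> t"
proof -
  have "w + (z + L * (t - w)) / (a + L) \<le> t \<longleftrightarrow> (z + L * (t - w)) / (a + L) \<le> t - w"
    by linarith
  also have "\<dots> \<longleftrightarrow> z + L * (t - w) \<le> (t - w) * (a + L)"
    using assms by (intro pos_divide_le_eq) simp
  also have "\<dots> \<longleftrightarrow> z \<le> (t - w) * a"
    by (simp add: algebra_simps)
  also have "\<dots> \<longleftrightarrow> z / a \<le> t - w"
    using assms by (simp add: pos_divide_le_eq)
  also have "\<dots> \<longleftrightarrow> w + z / a \<le> t"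
    by linarith
  finally show ?thesis .
qed

text \<open>\<open>L\<close> may be any positive common multiple of the other entries, so that
  \<open>k * lam\<close> with \<open>k * L\<close> is directly an instance.\<close>

lemma normal_rect_simplex_add_iff:
  fixes lam :: "nat ^ 'n"
  assumes pos: "\<And>j. lam $ j > 0" and L: "L > 0" and dvd: "\<And>j. j \<noteq> i \<Longrightarrow> lam $ j dvd L"
  shows "normal_polytope (rect_simplex (vec_upd lam i (lam $ i + L))) \<longleftrightarrow>
    normal_polytope (rect_simplex lam)"
proof -
  define lam' where "lam' = vec_upd lam i (lam $ i + L)"
  have pos': "lam' $ j > 0" for j using pos by (simp add: lam'_def)
  have lam'_i: "real (lam' $ i) = real (lam $ i) + real L" by (simp add: lam'_def)
  define w where "w = (\<lambda>x :: real ^ 'n. \<Sum>j\<in>UNIV - {i}. x $ j / real (lam $ j))"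
  have w: "(\<Sum>j\<in>UNIV - {i}. x $ j / real (lam $ j)) = w x" for x
    by (simp add: w_def)
  have w': "(\<Sum>j\<in>UNIV - {i}. x $ j / real (lam' $ j)) = w x" for x
    unfolding w_def by (intro sum.cong) (auto simp: lam'_def)
  have w_cong: "w x = w y" if "\<And>j. j \<noteq> i \<Longrightarrow> x $ j = y $ j" for x y
    unfolding w_def using that by (intro sum.cong) auto
  have w_upd [simp]: "w (vec_upd x i c) = w x" for x c
    by (rule w_cong) simp
  have w_sum: "w x = (\<Sum>m<k. w (y m))" if "\<And>j. j \<noteq> i \<Longrightarrow> x $ j = (\<Sum>m<k. y m $ j)"
    for x and y :: "nat \<Rightarrow> real ^ 'n" and k :: nat
    unfolding w_def sum.swap[of _ "UNIV - {i}"]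
    using that by (intro sum.cong) (auto simp: sum_divide_distrib)
  have w_int: "real L * w x \<in> \<int>" if "x \<in> lattice_points" for x
  proof -
    have "real L * (x $ j / real (lam $ j)) \<in> \<int>" if "j \<noteq> i" for j
    proof -
      from dvd[OF that] obtain q where "L = lam $ j * q" ..
      then have "real L * (x $ j / real (lam $ j)) = real q * x $ j"
        using pos[of j] by simp
      then show ?thesis using \<open>x \<in> lattice_points\<close> by (simp add: lattice_points_def)
    qed
    then show ?thesis unfolding w_def sum_distrib_left by (intro Ints_sum) auto
  qed
  have mem: "x \<in> rect_simplex lam \<longleftrightarrow> (\<forall>j. 0 \<le> x $ j) \<and> w x + x $ i / lam $ i \<le> 1"
    "x \<in> rect_simplex lam' \<longleftrightarrow> (\<forall>j. 0 \<le> x $ j) \<and> w x + x $ i / (real (lam $ i) + L) \<le> 1" for x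
    using mem_rect_simplex_split_iff[OF pos, of x i] mem_rect_simplex_split_iff[OF pos', of x i]
    by (simp_all only: w w' lam'_i)
  have memk: "x \<in> dilate k (rect_simplex lam) \<longleftrightarrow>
      (\<forall>j. 0 \<le> x $ j) \<and> w x + x $ i / lam $ i \<le> k"
    "x \<in> dilate k (rect_simplex lam') \<longleftrightarrow>
      (\<forall>j. 0 \<le> x $ j) \<and> w x + x $ i / (real (lam $ i) + L) \<le> k" if "k \<ge> 1" for x k
    using mem_dilate_rect_simplex_iff[OF pos that, of x i]
      mem_dilate_rect_simplex_iff[OF pos' that, of x i]
    by (simp_all only: w w' lam'_i)
  \<comment> \<open>This makes the shift \<open>s t x\<close> defined next nonnegative on the
    \<open>t\<close>-th dilate.\<close>
  have w_le: "w x \<le> t" if "\<forall>j. 0 \<le> x $ j" "w x + x $ i / a \<le> t" "a > 0" for x t a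
    using that divide_nonneg_pos[of "x $ i" a] by fastforce
  \<comment> \<open>The shift of coordinate \<open>i\<close>, with \<open>t = k\<close> for a point
    of the \<open>k\<close>-th dilate and \<open>t = 1\<close> for each summand. It depends only on
    the coordinates other than \<open>i\<close>.\<close>
  define s where "s = (\<lambda>t x. real L * (t - w x))"
  have s_int: "s (real k) x \<in> \<int>" if "x \<in> lattice_points" for k x
    using w_int[OF that] by (simp add: s_def right_diff_distrib)
  \<comment> \<open>Additivity of the shift: \<open>w\<close> is linear and the level
    \<open>k\<close> is a sum of \<open>k\<close> ones.\<close>
  have s_sum: "s (real k) x = (\<Sum>m<k. s 1 (y m))"
    if "\<And>j. j \<noteq> i \<Longrightarrow> x $ j = (\<Sum>m<k. y m $ j)" for x and y :: "nat \<Rightarrow> real ^ 'n" and k :: nat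
    using w_sum[of x y k, OF that] by (simp add: s_def sum_subtractf flip: sum_distrib_left)
  have a: "0 < real (lam $ i)" "0 < real L" "0 < real (lam $ i) + L" using pos[of i] L by auto
  note shear = shear_le_iff[OF a(1,2)]
  show ?thesis
    unfolding lam'_def[symmetric]
  proof
    assume norm: "normal_polytope (rect_simplex lam')"
    show "normal_polytope (rect_simplex lam)"
    proof (rule normal_rect_simplexI[OF pos, of i])
      fix k :: nat and x :: "real ^ 'n"
      assume k: "k \<ge> 1" and x: "x \<in> dilate k (rect_simplex lam) \<inter> lattice_points"
      have "w x \<le> k" using x w_le[OF _ _ a(1)] memk(1)[OF k] by blast
      then have "0 \<le> s (real k) x" by (simp add: s_def)
      then have "vec_upd x i (x $ i + s (real k) x) \<in> dilate k (rect_simplex lam') \<inter> lattice_points"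
        using x s_int[of x k] by (auto simp: memk[OF k] lattice_points_def shear s_def)
      then obtain y where y: "\<And>m. m < k \<Longrightarrow> y m \<in> rect_simplex lam' \<inter> lattice_points"
        and eq: "vec_upd x i (x $ i + s (real k) x) = (\<Sum>m<k. y m)"
        using norm k unfolding normal_polytope_def by blast
      have off: "x $ j = (\<Sum>m<k. y m $ j)" if "j \<noteq> i" for j
        using arg_cong[OF eq, of "\<lambda>v. v $ j"] that by simp
      have at: "x $ i + s (real k) x = (\<Sum>m<k. y m $ i)"
        using arg_cong[OF eq, of "\<lambda>v. v $ i"] by simp
      \<comment> \<open>Undoing the shear on a single summand can make coordinate \<open>i\<close>
        negative, hence the \<open>max\<close>.\<close>
      define y' where "y' = (\<lambda>m. vec_upd (y m) i (max 0 (y m $ i - s 1 (y m))))"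
      have "y' m \<in> rect_simplex lam \<inter> lattice_points" if "m < k" for m
      proof -
        \<comment> \<open>This is the membership inequality when the truncated value is 0; the next
          fact covers the other case.\<close>
        have "w (y m) \<le> 1" using y[OF that] w_le[OF _ _ a(3)] mem(2) by blast
        \<comment> \<open>The shear is read backwards: for \<open>z = y m $ i - s 1 (y m)\<close>
          the sheared value is \<open>y m $ i\<close>.\<close>
        moreover have "w (y m) + (y m $ i - s 1 (y m)) / lam $ i \<le> 1"
          using y[OF that] shear[of "w (y m)" "y m $ i - s 1 (y m)" 1]
          by (simp add: mem s_def)
        ultimately show ?thesis
          using y[OF that] s_int[of "y m" 1]
          by (auto simp: y'_def mem lattice_points_def max_def)
      qed
      moreover have "x $ i \<le> (\<Sum>m<k. y' m $ i)"
      proof -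
        have "x $ i = (\<Sum>m<k. y m $ i - s 1 (y m))"
          using at s_sum[of x y k, OF off] by (simp add: sum_subtractf)
        also have "\<dots> \<le> (\<Sum>m<k. y' m $ i)"
          by (intro sum_mono) (simp add: y'_def)
        finally show ?thesis .
      qed
      ultimately show "\<exists>y. (\<forall>m<k. y m \<in> rect_simplex lam \<inter> lattice_points) \<and>
        (\<forall>j. j \<noteq> i \<longrightarrow> x $ j = (\<Sum>m<k. y m $ j)) \<and> x $ i \<le> (\<Sum>m<k. y m $ i)"
        using off by (intro exI[of _ y']) (auto simp: y'_def)
    qed
  next
    assume norm: "normal_polytope (rect_simplex lam)"
    show "normal_polytope (rect_simplex lam')"
    proof (rule normal_rect_simplexI[OF pos', of i])
      fix k :: nat and x :: "real ^ 'n"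
      assume k: "k \<ge> 1" and x: "x \<in> dilate k (rect_simplex lam') \<inter> lattice_points"
      have "w x \<le> k" using x w_le[OF _ _ a(3)] memk(2)[OF k] by blast
      moreover have "w x + (x $ i - s (real k) x) / lam $ i \<le> k"
        using x shear[of "w x" "x $ i - s (real k) x" k] by (simp add: memk[OF k] s_def)
      \<comment> \<open>In this direction the truncation acts on \<open>x\<close> before it is
        decomposed; the summands are then sheared by nonnegative amounts.\<close>
      ultimately have "vec_upd x i (max 0 (x $ i - s (real k) x))
          \<in> dilate k (rect_simplex lam) \<inter> lattice_points"
        using x s_int[of x k] by (auto simp: memk[OF k] lattice_points_def max_def)
      then obtain y where y: "\<And>m. m < k \<Longrightarrow> y m \<in> rect_simplex lam \<inter> lattice_points"
        and eq: "vec_upd x i (max 0 (x $ i - s (real k) x)) = (\<Sum>m<k. y m)"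
        using norm k unfolding normal_polytope_def by blast
      have off: "x $ j = (\<Sum>m<k. y m $ j)" if "j \<noteq> i" for j
        using arg_cong[OF eq, of "\<lambda>v. v $ j"] that by simp
      have at: "x $ i - s (real k) x \<le> (\<Sum>m<k. y m $ i)"
        using arg_cong[OF eq, of "\<lambda>v. v $ i"] by simp
      define y' where "y' = (\<lambda>m. vec_upd (y m) i (y m $ i + s 1 (y m)))"
      have "y' m \<in> rect_simplex lam' \<inter> lattice_points" if "m < k" for m
      proof -
        have "w (y m) \<le> 1" using y[OF that] w_le[OF _ _ a(1)] mem(1) by blast
        then have "0 \<le> s 1 (y m)" by (simp add: s_def)
        then show ?thesis
          using y[OF that] s_int[of "y m" 1] shear[of "w (y m)" "y m $ i" 1]
          by (auto simp: y'_def mem lattice_points_def s_def)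
      qed
      moreover have "x $ i \<le> (\<Sum>m<k. y' m $ i)"
        using at s_sum[of x y k, OF off] by (simp add: y'_def sum.distrib)
      ultimately show "\<exists>y. (\<forall>m<k. y m \<in> rect_simplex lam' \<inter> lattice_points) \<and>
        (\<forall>j. j \<noteq> i \<longrightarrow> x $ j = (\<Sum>m<k. y m $ j)) \<and> x $ i \<le> (\<Sum>m<k. y m $ i)"
        using off by (intro exI[of _ y']) (auto simp: y'_def)
    qed
  qed
qed

theorem proposition3p27:
  fixes lam :: "nat ^ 'n" and i :: 'n
  assumes "\<And>j. lam $ j > 0"
  shows "mu_norm (rect_simplex lam) =
    mu_norm (rect_simplex
      (\<chi> j. if j = i then lam $ i + Lcm ((\<lambda>m. lam $ m) ` (UNIV - {i})) else lam $ j))"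
proof -
  define L where "L = Lcm ((\<lambda>m. lam $ m) ` (UNIV - {i}))"
  \<comment> \<open>A finite set of positive numbers has nonzero \<open>Lcm\<close>; in dimension
    one the set is empty and \<open>L\<close> is 1.\<close>
  have "L \<noteq> 0" unfolding L_def using assms by (subst Lcm_0_iff) (auto simp: image_iff dest: sym)
  have dvd: "lam $ j dvd L" if "j \<noteq> i" for j
    unfolding L_def using that by (intro dvd_Lcm) auto
  have "normal_polytope (dilate k (rect_simplex (vec_upd lam i (lam $ i + L)))) \<longleftrightarrow>
      normal_polytope (dilate k (rect_simplex lam))" if "k \<ge> 1" for k
  proof -
    \<comment> \<open>Dilating the modified simplex amounts to adding \<open>k * L\<close> to entry
      \<open>i\<close> of \<open>k * lam\<close>.\<close>
    have "(\<chi> j. k * vec_upd lam i (lam $ i + L) $ j)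
        = vec_upd (\<chi> j. k * lam $ j) i ((\<chi> j. k * lam $ j) $ i + k * L)"
      by (simp add: vec_eq_iff distrib_left)
    then show ?thesis
      using that assms \<open>L \<noteq> 0\<close> dvd
      by (simp only: dilate_rect_simplex) (intro normal_rect_simplex_add_iff; simp)
  qed
  \<comment> \<open>The conditions under the two minima agree for each \<open>k0\<close>, as
    \<open>k0 \<ge> 1\<close> forces \<open>k \<ge> 1\<close>.\<close>
  then have "k0 \<ge> 1 \<and> (\<forall>k\<ge>k0. normal_polytope (dilate k (rect_simplex lam))) \<longleftrightarrow>
      k0 \<ge> 1 \<and> (\<forall>k\<ge>k0. normal_polytope (dilate k (rect_simplex (vec_upd lam i (lam $ i + L)))))"
    for k0 by (meson order_trans)
  then show ?thesis
    unfolding mu_norm_def L_def by presburger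
qed

end
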